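(* There is a deterministic comparison-based algorithm that computes $MAX_n^{\boxplus n}$ (equivalently $MIN_n^{\boxplus n}$) on inputs of length $2n-1$ using time $O(n\log n)$ and space $O(\log n)$ bits.
   Context: $MAX_n(a)$ (resp. $MIN_n(a)$) is the largest (resp. smallest) symbol of a length-$n$ string $a$ over a linearly ordered set. $MAX_n^{\boxplus n}(x)=(MAX_n(x_i\ldots x_{i+n-1}))_{i=1}^n$ for $x=x_1\ldots x_{2n-1}$, and similarly for $MIN$. Space excludes the read-only input and write-only output. *)

theory Defs
  imports
    Complex_Main
    "HOL-Library.Landau_Symbols"
    "HOL-Library.Log_Nat"
    "HOL-Library.Multiset"
begin

text \<open>
  The model is a deterministic random access machine with a read-only input array, a write-only
  output array and a working memory of natural numbers. A program can address the input symbols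
  by (0-based) index, but it can neither store a symbol nor test it for anything except the
  outcome of an order comparison with another symbol.

  In \<open>Compare a b l\<close> and \<open>Output p a\<close> the operands are memory cells that hold the
  indices involved.
\<close>

datatype instr =
    Const nat nat
  | Copy nat nat
  | Add nat nat nat
  | Sub nat nat nat
  | Half nat nat
  | Load nat nat
  | Store nat nat
  | Jump nat
  | JumpLess nat nat nat
  | Compare nat nat nat
  | Output nat nat
  | Halt

text \<open>
  \<open>written\<close> is the log of all writes to the output array, each a pair of an output index and a
  symbol, the latest first. No instruction reads it.
\<close>

record 'a config =
  pc :: nat
  mem :: "nat \<Rightarrow> nat"
  written :: "(nat \<times> 'a) list"

definition set_cell :: "nat \<Rightarrow> nat \<Rightarrow> 'a config \<Rightarrow> 'a config" where
  "set_cell a v c = c\<lparr>pc := Suc (pc c), mem := (mem c)(a := v)\<rparr>"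

definition branch :: "bool \<Rightarrow> nat \<Rightarrow> 'a config \<Rightarrow> 'a config" where
  "branch b l c = c\<lparr>pc := (if b then l else Suc (pc c))\<rparr>"

text \<open>
  \<open>None\<close> means that there is no successor configuration: the machine has halted, or it
  is stuck because of an input index out of range.
\<close>

fun exec :: "'a::linorder list \<Rightarrow> instr \<Rightarrow> 'a config \<Rightarrow> 'a config option" where
  "exec x (Const a k) c = Some (set_cell a k c)"
| "exec x (Copy a b) c = Some (set_cell a (mem c b) c)"
| "exec x (Add a b d) c = Some (set_cell a (mem c b + mem c d) c)"
| "exec x (Sub a b d) c = Some (set_cell a (mem c b - mem c d) c)"
| "exec x (Half a b) c = Some (set_cell a (mem c b div 2) c)"
| "exec x (Load a b) c = Some (set_cell a (mem c (mem c b)) c)"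
| "exec x (Store a b) c = Some (set_cell (mem c a) (mem c b) c)"
| "exec x (Jump l) c = Some (branch True l c)"
| "exec x (JumpLess a b l) c = Some (branch (mem c a < mem c b) l c)"
| "exec x (Compare a b l) c =
     (if mem c a < length x \<and> mem c b < length x
      then Some (branch (x ! mem c a < x ! mem c b) l c) else None)"
| "exec x (Output p a) c =
     (if mem c a < length x
      then Some (c\<lparr>pc := Suc (pc c), written := (mem c p, x ! mem c a) # written c\<rparr>) else None)"
| "exec x Halt c = None"

definition step :: "instr list \<Rightarrow> 'a::linorder list \<Rightarrow> 'a config \<Rightarrow> 'a config option" where
  "step P x c = (if pc c < length P then exec x (P ! pc c) c else None)"

definition halted :: "instr list \<Rightarrow> 'a config \<Rightarrow> bool" where
  "halted P c \<longleftrightarrow> pc c < length P \<and> P ! pc c = Halt"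

text \<open>Initially cell 0 holds the length of the input and every other cell is 0.\<close>

definition init :: "'a list \<Rightarrow> 'a config" where
  "init x = \<lparr>pc = 0, mem = (\<lambda>_. 0)(0 := length x), written = []\<rparr>"

primrec run :: "instr list \<Rightarrow> 'a::linorder list \<Rightarrow> nat \<Rightarrow> 'a config option" where
  "run P x 0 = Some (init x)"
| "run P x (Suc t) = Option.bind (run P x t) (step P x)"

text \<open>
  The space of a configuration in bits. \<open>floorlog 2 k\<close> is the length of the binary representation
  of \<open>k\<close>. A nonzero cell is charged for its address as well as for its contents, so that no
  information can be hidden in the choice of the address; only finitely many cells are nonzero in a
  reachable configuration. The program counter is below \<open>length P\<close> whenever an instruction is
  executed and is not charged, as \<open>P\<close> does not depend on the input.
\<close>

definition space :: "'a config \<Rightarrow> nat" where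
  "space c = (\<Sum>a | mem c a \<noteq> 0. floorlog 2 a + floorlog 2 (mem c a))"

text \<open>
  On input \<open>x\<close>, program \<open>P\<close> halts after at most \<open>T\<close> steps, never uses more than \<open>S\<close> bits, and
  writes every entry of \<open>y\<close> to its place exactly once, in whatever order, and nothing else.
  Each instruction takes unit time; \<open>S\<close> also bounds the size of all numbers that occur in the
  memory.
\<close>

definition computes_within ::
    "instr list \<Rightarrow> 'a::linorder list \<Rightarrow> 'a list \<Rightarrow> nat \<Rightarrow> nat \<Rightarrow> bool" where
  "computes_within P x y T S \<longleftrightarrow>
     (\<exists>t c. t \<le> T \<and> run P x t = Some c \<and> halted P c \<and>
        mset (written c) = mset (List.enumerate 0 y) \<and>
        (\<forall>s\<le>t. \<forall>d. run P x s = Some d \<longrightarrow> space d \<le> S))"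

text \<open>
  \<open>sliding n t f x\<close> applies \<open>f\<close> to the first \<open>t\<close> windows of length \<open>n\<close> of \<open>x\<close>, which is meant
  to have length \<open>n + t - 1\<close>.
\<close>

definition sliding :: "nat \<Rightarrow> nat \<Rightarrow> ('a list \<Rightarrow> 'b) \<Rightarrow> 'a list \<Rightarrow> 'b list" where
  "sliding n t f x = map (\<lambda>i. f (take n (drop i x))) [0..<t]"

end

theory Submission
  imports Defs "HOL-Library.Dual_Ordered_Lattice" "HOL-Library.More_List"
begin

text \<open>
  Every window contains the middle symbol \<open>x ! m\<close>, where \<open>m = n - 1\<close>, so the window at \<open>i\<close> is the
  union of the left part \<open>{i..m}\<close> and the right part \<open>{m..m + i}\<close>. The left parts shrink and the
  right parts grow with \<open>i\<close>, so there is a threshold \<open>k\<close> such that the maximum comes from the left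
  part for \<open>i < k\<close> and from the right part for \<open>i \<ge> k\<close>. Two pointers \<open>l\<close> and \<open>h\<close> moving towards
  each other find \<open>k\<close>: if the maximum of the left part at \<open>h - 1\<close> is at least that of the right part
  at \<open>l\<close>, then \<open>l < k\<close>; otherwise \<open>k \<le> h - 1\<close>. Afterwards \<open>l\<close> moves on upwards and \<open>h\<close> downwards,
  and each outputs its running maximum. This takes linear time and a constant number of cells.
  Minima are maxima for the dual order, on which a program acts as if the operands of each of its
  comparisons were exchanged.
\<close>

section \<open>Runs with bounded time and space\<close>

inductive reaches_within ::
    "instr list \<Rightarrow> 'a::linorder list \<Rightarrow> nat \<Rightarrow> nat \<Rightarrow> 'a config \<Rightarrow> 'a config \<Rightarrow> bool"
  for P x where
  stay: "space c \<le> S \<Longrightarrow> reaches_within P x k S c c"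
| step: "space c \<le> S \<Longrightarrow> step P x c = Some d \<Longrightarrow> reaches_within P x k S d e \<Longrightarrow>
    reaches_within P x (Suc k) S c e"

lemma reaches_within_mono:
  assumes "reaches_within P x k S c d" "k \<le> l"
  shows "reaches_within P x l S c d"
  using assms
proof (induction arbitrary: l)
  case (step c S d k e)
  then obtain l' where "l = Suc l'" "k \<le> l'" by (cases l) auto
  with step show ?case by (auto intro: reaches_within.step)
qed (rule reaches_within.stay)

lemma reaches_within_trans [trans]:
  assumes "reaches_within P x k S c d" "reaches_within P x l S d e"
  shows "reaches_within P x (k + l) S c e"
  using assms
proof induction
  case (stay c S k)
  from stay(2) show ?case by (rule reaches_within_mono) simp
next
  case (step c S d k e)
  then show ?case by (auto intro: reaches_within.step)
qed

text \<open>
  The conditionals keep the simplifier from unfolding the recursion before it has evaluated their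
  tests, so that this equation executes straight-line code symbolically.
\<close>

lemma reaches_within_rec:
  "reaches_within P x k S c e \<longleftrightarrow>
     (if k = 0 \<or> c = e then space c \<le> S \<and> c = e
      else space c \<le> S \<and>
        (case step P x c of None \<Rightarrow> False | Some d \<Rightarrow> reaches_within P x (k - 1) S d e))"
  by (subst reaches_within.simps) (auto simp: gr0_conv_Suc split: option.splits)

lemma run_of_reaches_within:
  assumes "reaches_within P x k S c d" "run P x s = Some c"
  shows "\<exists>t\<le>s + k. run P x t = Some d \<and> (\<forall>r\<in>{s..t}. \<forall>e. run P x r = Some e \<longrightarrow> space e \<le> S)"
  using assms
proof (induction arbitrary: s)
  case (stay c S k)
  then show ?case by (intro exI[of _ s]) auto
next
  case (step c S d k e)
  then have "run P x (Suc s) = Some d" by simp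
  with step.IH obtain t where t: "t \<le> Suc s + k" "run P x t = Some e"
    "\<forall>r\<in>{Suc s..t}. \<forall>e. run P x r = Some e \<longrightarrow> space e \<le> S"
    by blast
  have "space f \<le> S" if "r \<in> {s..t}" "run P x r = Some f" for r f
    using that step t(3) by (cases "r = s") auto
  with t show ?case by auto
qed

lemma computes_within_if_reaches_within:
  assumes "reaches_within P x T S (init x) c" "halted P c"
    "mset (written c) = mset (List.enumerate 0 y)"
  shows "computes_within P x y T S"
  using run_of_reaches_within[OF assms(1), of 0] assms(2,3) by (auto simp: computes_within_def)

section \<open>Memories of finitely many cells\<close>

definition config_of :: "nat \<Rightarrow> nat list \<Rightarrow> (nat \<times> 'a) list \<Rightarrow> 'a config" where
  "config_of i vs w = \<lparr>pc = i, mem = nth_default 0 vs, written = w\<rparr>"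

lemma pc_config_of [simp]: "pc (config_of i vs w) = i"
  and mem_config_of: "mem (config_of i vs w) = nth_default 0 vs"
  and written_config_of [simp]: "written (config_of i vs w) = w"
  by (simp_all add: config_of_def)

lemma config_of_neq [simp]: "i \<noteq> j \<Longrightarrow> config_of i vs w \<noteq> config_of j vs' w'"
  by (simp add: config_of_def)

lemma mem_config_of_nth [simp]: "a < length vs \<Longrightarrow> mem (config_of i vs w) a = vs ! a"
  by (simp add: mem_config_of nth_default_nth)

lemma set_cell_config_of [simp]:
  "a < length vs \<Longrightarrow> set_cell a v (config_of i vs w) = config_of (Suc i) (vs[a := v]) w"
  by (auto simp: set_cell_def config_of_def nth_default_def fun_eq_iff)

lemma branch_config_of [simp]:
  "branch b l (config_of i vs w) = config_of (if b then l else Suc i) vs w"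
  by (simp add: branch_def config_of_def)

lemma output_config_of [simp]:
  "(config_of i vs w)\<lparr>pc := j, written := w'\<rparr> = config_of j vs w'"
  by (simp add: config_of_def)

lemma init_eq_config_of: "init x = config_of 0 (length x # replicate k 0) []"
  by (auto simp: init_def config_of_def nth_default_def fun_eq_iff nth_Cons')

lemma space_config_of_le:
  assumes "\<forall>v\<in>set vs. v \<le> b"
  shows "space (config_of i vs w) \<le> length vs * (floorlog 2 (length vs) + floorlog 2 b)"
proof -
  have nonzero: "a < length vs \<and> mem (config_of i vs w) a \<le> b"
    if "mem (config_of i vs w) a \<noteq> 0" for a
    using that assms by (auto simp: mem_config_of nth_default_def split: if_splits)
  have "space (config_of i vs w)
      \<le> (\<Sum>a | mem (config_of i vs w) a \<noteq> 0. floorlog 2 (length vs) + floorlog 2 b)"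
    unfolding space_def using nonzero
    by (intro sum_mono add_mono floorlog_mono) (auto intro: less_imp_le)
  also have "\<dots> \<le> (\<Sum>a<length vs. floorlog 2 (length vs) + floorlog 2 b)"
    using nonzero by (intro sum_mono2) auto
  finally show ?thesis by simp
qed

section \<open>Reversing the order\<close>

lemma enumerate_map: "List.enumerate n (map g y) = map (apsnd g) (List.enumerate n y)"
  by (induction y arbitrary: n) simp_all

fun swap_compare :: "instr \<Rightarrow> instr" where
  "swap_compare (Compare a b l) = Compare b a l"
| "swap_compare i = i"

definition map_config :: "('a \<Rightarrow> 'b) \<Rightarrow> 'a config \<Rightarrow> 'b config" where
  "map_config g c = \<lparr>pc = pc c, mem = mem c, written = map (apsnd g) (written c)\<rparr>"

context
  fixes g :: "'a::linorder \<Rightarrow> 'b::linorder"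
  assumes reverses: "g a < g b \<longleftrightarrow> b < a"
begin

lemma exec_reversed:
  "exec (map g x) i (map_config g c) = map_option (map_config g) (exec x (swap_compare i) c)"
  by (cases i) (auto simp: map_config_def set_cell_def branch_def reverses)

lemma step_reversed:
  "step P (map g x) (map_config g c) = map_option (map_config g) (step (map swap_compare P) x c)"
  using exec_reversed by (simp add: step_def) (simp add: map_config_def)

lemma run_reversed:
  "run P (map g x) t = map_option (map_config g) (run (map swap_compare P) x t)"
proof (induction t)
  case 0
  then show ?case by (simp add: init_def map_config_def)
next
  case (Suc t)
  then show ?case
    by (cases "run (map swap_compare P) x t") (simp_all add: step_reversed)
qed

lemma computes_within_reversed:
  assumes "computes_within P (map g x) (map g y) T S"
  shows "computes_within (map swap_compare P) x y T S"
proof -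
  have "inj g"
    by (rule injI) (metis reverses less_irrefl linorder_neqE)
  then have inj: "inj (image_mset (apsnd g) :: (nat \<times> 'a) multiset \<Rightarrow> _)"
    by (intro multiset.inj_map) auto
  obtain t c where t: "t \<le> T" and run: "run P (map g x) t = Some c" and halt: "halted P c"
    and out: "mset (written c) = mset (List.enumerate 0 (map g y))"
    and space: "\<forall>s\<le>t. \<forall>d. run P (map g x) s = Some d \<longrightarrow> space d \<le> S"
    using assms by (auto simp: computes_within_def)
  from run obtain c' where run': "run (map swap_compare P) x t = Some c'"
    and c: "c = map_config g c'"
    by (auto simp: run_reversed)
  have "halted (map swap_compare P) c'"
    using halt by (auto simp: halted_def c map_config_def)
  moreover have "image_mset (apsnd g) (mset (written c')) =
      image_mset (apsnd g) (mset (List.enumerate 0 y))"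
    using out by (simp add: c map_config_def enumerate_map)
  then have "mset (written c') = mset (List.enumerate 0 y)"
    by (rule injD[OF inj])
  moreover have "space d \<le> S" if "s \<le> t" "run (map swap_compare P) x s = Some d" for s d
  proof -
    have "space (map_config g d) \<le> S"
      using space that by (simp add: run_reversed)
    then show ?thesis by (simp add: space_def map_config_def)
  qed
  ultimately show ?thesis
    using t run' unfolding computes_within_def by blast
qed

end

instance dual :: (linorder) linorder
  by standard (auto simp: dual_less_eq_iff)

lemma Max_dual_image: "finite A \<Longrightarrow> A \<noteq> {} \<Longrightarrow> Max (dual ` A) = dual (Min A)"
  by (rule Max_eqI) auto

section \<open>Window maxima around a common middle\<close>

definition left_max :: "(nat \<Rightarrow> 'a::linorder) \<Rightarrow> nat \<Rightarrow> nat \<Rightarrow> 'a" where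
  "left_max f m i = Max (f ` {i..m})"

definition right_max :: "(nat \<Rightarrow> 'a::linorder) \<Rightarrow> nat \<Rightarrow> nat \<Rightarrow> 'a" where
  "right_max f m i = Max (f ` {m..m + i})"

definition window_max :: "(nat \<Rightarrow> 'a::linorder) \<Rightarrow> nat \<Rightarrow> nat \<Rightarrow> 'a" where
  "window_max f m i = Max (f ` {i..i + m})"

lemma window_max_eq_max:
  assumes "i \<le> m"
  shows "window_max f m i = max (left_max f m i) (right_max f m i)"
proof -
  have "{i..i + m} = {i..m} \<union> {m..m + i}" using assms by auto
  then show ?thesis
    using assms by (simp add: window_max_def left_max_def right_max_def image_Un Max_Un)
qed

lemma left_max_antimono: "i \<le> j \<Longrightarrow> j \<le> m \<Longrightarrow> left_max f m j \<le> left_max f m i"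
  unfolding left_max_def by (intro Max_mono image_mono) auto

lemma right_max_mono: "i \<le> j \<Longrightarrow> right_max f m i \<le> right_max f m j"
  unfolding right_max_def by (intro Max_mono image_mono) auto

definition threshold_between :: "(nat \<Rightarrow> 'a::linorder) \<Rightarrow> nat \<Rightarrow> nat \<Rightarrow> nat \<Rightarrow> bool" where
  "threshold_between f m l h \<longleftrightarrow>
     (\<forall>i<l. right_max f m i \<le> left_max f m i) \<and> (\<forall>i\<in>{h..m}. left_max f m i \<le> right_max f m i)"

lemma threshold_between_full: "threshold_between f m 0 (Suc m)"
  by (simp add: threshold_between_def)

lemma threshold_between_Suc_lower:
  assumes "threshold_between f m l h" "l \<le> j" "j \<le> m" "right_max f m l \<le> left_max f m j"
  shows "threshold_between f m (Suc l) h"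
proof -
  have "right_max f m l \<le> left_max f m l"
    using assms(4) left_max_antimono[OF assms(2,3)] by (rule order_trans)
  with assms(1) show ?thesis by (auto simp: threshold_between_def less_Suc_eq)
qed

lemma threshold_between_upper:
  assumes "threshold_between f m l (Suc j)" "l \<le> j" "left_max f m j \<le> right_max f m l"
  shows "threshold_between f m l j"
proof -
  have "left_max f m j \<le> right_max f m j"
    using assms(3) right_max_mono[OF assms(2)] by (rule order_trans)
  moreover have "{j..m} \<subseteq> insert j {Suc j..m}" by auto
  ultimately show ?thesis
    using assms(1) by (auto simp: threshold_between_def)
qed

definition argmax_on :: "('b \<Rightarrow> 'a::linorder) \<Rightarrow> 'b set \<Rightarrow> 'b \<Rightarrow> bool" where
  "argmax_on f A a \<longleftrightarrow> a \<in> A \<and> (\<forall>k\<in>A. f k \<le> f a)"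

lemma Max_image_eq_argmax: "finite A \<Longrightarrow> argmax_on f A a \<Longrightarrow> Max (f ` A) = f a"
  by (rule Max_eqI) (auto simp: argmax_on_def)

lemma left_max_eq_argmax: "argmax_on f {i..m} a \<Longrightarrow> left_max f m i = f a"
  by (simp add: left_max_def Max_image_eq_argmax)

lemma right_max_eq_argmax: "argmax_on f {m..m + i} b \<Longrightarrow> right_max f m i = f b"
  by (simp add: right_max_def Max_image_eq_argmax)

definition better :: "('b \<Rightarrow> 'a::linorder) \<Rightarrow> 'b \<Rightarrow> 'b \<Rightarrow> 'b" where
  "better f a p = (if f p < f a then a else p)"

text \<open>
  The search compares with the next position \<open>p\<close> of a part without knowing yet whether the part
  will be extended by it, so an extremal position recorded for \<open>A\<close> may already account for \<open>p\<close>.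
\<close>

definition argmax_pending :: "('b \<Rightarrow> 'a::linorder) \<Rightarrow> 'b set \<Rightarrow> 'b \<Rightarrow> 'b \<Rightarrow> bool" where
  "argmax_pending f A p a \<longleftrightarrow> a \<in> insert p A \<and> (\<forall>k\<in>A. f k \<le> f a)"

lemma argmax_on_better:
  "argmax_pending f A p a \<Longrightarrow> argmax_on f (insert p A) (better f a p)"
  by (auto simp: argmax_pending_def argmax_on_def better_def intro: order_trans less_imp_le)

abbreviation left_pending :: "(nat \<Rightarrow> 'a::linorder) \<Rightarrow> nat \<Rightarrow> nat \<Rightarrow> nat \<Rightarrow> bool" where
  "left_pending f m h \<equiv> argmax_pending f {h..m} (h - 1)"

abbreviation right_pending :: "(nat \<Rightarrow> 'a::linorder) \<Rightarrow> nat \<Rightarrow> nat \<Rightarrow> nat \<Rightarrow> bool" where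
  "right_pending f m l \<equiv> argmax_pending f {m..<m + l} (m + l)"

lemma argmax_on_left:
  assumes "left_pending f m (Suc j) a" "j \<le> m"
  shows "argmax_on f {j..m} (better f a j)"
  using argmax_on_better[OF assms(1)] assms(2) by (simp add: atLeastAtMost_insertL)

lemma argmax_on_right:
  assumes "right_pending f m l b"
  shows "argmax_on f {m..m + l} (better f b (m + l))"
  using argmax_on_better[OF assms]
  by (simp add: atLeastLessThanSuc flip: atLeastLessThanSuc_atLeastAtMost)

lemma left_pending_if_argmax_on:
  assumes "argmax_on f {j..m} a"
  shows "left_pending f m j a" "left_pending f m (Suc j) a"
  using assms by (auto simp: argmax_on_def argmax_pending_def)

lemma right_pending_if_argmax_on:
  assumes "argmax_on f {m..m + l} b"
  shows "right_pending f m l b" "right_pending f m (Suc l) b"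
  using assms by (auto simp: argmax_on_def argmax_pending_def)

definition search_invariant ::
    "(nat \<Rightarrow> 'a::linorder) \<Rightarrow> nat \<Rightarrow> nat \<Rightarrow> nat \<Rightarrow> nat \<Rightarrow> nat \<Rightarrow> bool" where
  "search_invariant f m l h a b \<longleftrightarrow> l \<le> h \<and> h \<le> Suc m \<and> a \<le> m \<and> b \<le> 2 * m \<and>
     threshold_between f m l h \<and> left_pending f m h a \<and> right_pending f m l b"

lemma search_invariant_initial: "search_invariant f m 0 (Suc m) m m"
  by (simp add: search_invariant_def threshold_between_full argmax_pending_def)

lemma search_invariant_step:
  assumes inv: "search_invariant f m l (Suc j) a b" and "l \<le> j"
  defines "a' \<equiv> better f a j" and "b' \<equiv> better f b (m + l)"
  shows "f a' < f b' \<Longrightarrow> search_invariant f m l j a' b'"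
    and "\<not> f a' < f b' \<Longrightarrow> search_invariant f m (Suc l) (Suc j) a' b'"
proof -
  have "j \<le> m" and threshold: "threshold_between f m l (Suc j)"
    using inv by (simp_all add: search_invariant_def)
  have left: "argmax_on f {j..m} a'" and right: "argmax_on f {m..m + l} b'"
    using inv \<open>j \<le> m\<close> unfolding a'_def b'_def search_invariant_def
    by (simp_all add: argmax_on_left argmax_on_right)
  have bounds: "a' \<le> m" "b' \<le> 2 * m"
    using left right \<open>l \<le> j\<close> \<open>j \<le> m\<close> by (auto simp: argmax_on_def)
  note pending = left_pending_if_argmax_on[OF left] right_pending_if_argmax_on[OF right]
  note maxima = left_max_eq_argmax[OF left] right_max_eq_argmax[OF right]
  show "search_invariant f m l j a' b'" if "f a' < f b'"
    using threshold_between_upper[OF threshold \<open>l \<le> j\<close>] that \<open>l \<le> j\<close> \<open>j \<le> m\<close> bounds pending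
    by (simp add: search_invariant_def maxima)
  show "search_invariant f m (Suc l) (Suc j) a' b'" if "\<not> f a' < f b'"
    using threshold_between_Suc_lower[OF threshold \<open>l \<le> j\<close> \<open>j \<le> m\<close>] that \<open>l \<le> j\<close> \<open>j \<le> m\<close>
      bounds pending
    by (simp add: search_invariant_def maxima)
qed

section \<open>The two-pointer program\<close>

abbreviation (input) "len_cell \<equiv> 0 :: nat"
abbreviation (input) "mid_cell \<equiv> 1 :: nat"
abbreviation (input) "lower_cell \<equiv> 2 :: nat"
abbreviation (input) "upper_cell \<equiv> 3 :: nat"
abbreviation (input) "one_cell \<equiv> 4 :: nat"
abbreviation (input) "left_argmax_cell \<equiv> 5 :: nat"
abbreviation (input) "right_argmax_cell \<equiv> 6 :: nat"
abbreviation (input) "next_cell \<equiv> 7 :: nat"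

definition max_program :: "instr list" where
  "max_program =
    [Const one_cell 1,
     Half mid_cell len_cell,
     Add upper_cell mid_cell one_cell,
     Copy left_argmax_cell mid_cell,
     Copy right_argmax_cell mid_cell,
     Jump 16,
     \<comment> \<open>6: search for the threshold, with loop test at 16\<close>
     Sub next_cell upper_cell one_cell,
     Compare next_cell left_argmax_cell 9,
     Copy left_argmax_cell next_cell,
     Add next_cell mid_cell lower_cell,
     Compare next_cell right_argmax_cell 12,
     Copy right_argmax_cell next_cell,
     Compare left_argmax_cell right_argmax_cell 15,
     Add lower_cell lower_cell one_cell,
     Jump 16,
     Sub upper_cell upper_cell one_cell,
     JumpLess lower_cell upper_cell 6,
     \<comment> \<open>17: output the maxima of the right parts\<close>
     JumpLess mid_cell lower_cell 24,
     Add next_cell mid_cell lower_cell,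
     Compare next_cell right_argmax_cell 21,
     Copy right_argmax_cell next_cell,
     Output lower_cell right_argmax_cell,
     Add lower_cell lower_cell one_cell,
     Jump 17,
     \<comment> \<open>24: output the maxima of the left parts\<close>
     JumpLess upper_cell one_cell 30,
     Sub upper_cell upper_cell one_cell,
     Compare upper_cell left_argmax_cell 28,
     Copy left_argmax_cell upper_cell,
     Output upper_cell left_argmax_cell,
     Jump 24,
     Halt]"

definition max_time :: "nat \<Rightarrow> nat" where
  "max_time n = 17 * n + 9"

definition max_space :: "nat \<Rightarrow> nat" where
  "max_space n = 8 * (floorlog 2 8 + floorlog 2 (2 * n))"

lemma space_config_of_le_max_space [simp]:
  assumes "length vs = 8" "\<forall>v\<in>set vs. v \<le> 2 * n"
  shows "space (config_of i vs w) \<le> max_space n"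
  using space_config_of_le[OF assms(2)] assms(1) by (simp add: max_space_def)

context
  notes upt_Suc [simp del]
  fixes x :: "'a::linorder list" and m :: nat
  assumes length_x: "length x = 2 * m + 1"
begin

abbreviation config ::
    "nat \<Rightarrow> nat \<Rightarrow> nat \<Rightarrow> nat \<Rightarrow> nat \<Rightarrow> nat \<Rightarrow> (nat \<times> 'a) list \<Rightarrow> 'a config" where
  "config i l h a b p \<equiv> config_of i [2 * m + 1, m, l, h, 1, a, b, p]"

abbreviation reaches where
  "reaches k \<equiv> reaches_within max_program x k (max_space (Suc m))"

lemmas run_simps = reaches_within_rec step_def max_program_def length_x better_def

lemma setup_phase: "reaches 6 (init x) (config 16 0 (Suc m) m m 0 [])"
proof -
  have "init x = config_of 0 [2 * m + 1, 0, 0, 0, 0, 0, 0, 0] []"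
    using init_eq_config_of[of x 7] by (simp add: length_x numeral_eq_Suc)
  then show ?thesis
    by (simp add: run_simps)
qed

lemma search_loop_body:
  assumes "l \<le> j" "j \<le> m" "a \<le> m" "b \<le> 2 * m" "p \<le> 2 * m"
  defines "a' \<equiv> better ((!) x) a j" and "b' \<equiv> better ((!) x) b (m + l)"
  shows "reaches 10 (config 16 l (Suc j) a b p w)
    (if x ! a' < x ! b' then config 16 l j a' b' (m + l) w
     else config 16 (Suc l) (Suc j) a' b' (m + l) w)"
proof -
  have bounds: "a' \<le> m" "b' \<le> 2 * m"
    using assms by (auto simp: better_def)
  have "reaches 2 (config 16 l (Suc j) a b p w) (config 7 l (Suc j) a b j w)"
    using assms by (simp add: run_simps)
  also have "reaches 2 \<dots> (config 9 l (Suc j) a' b j w)"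
    using assms by (simp add: run_simps)
  also have "reaches 1 \<dots> (config 10 l (Suc j) a' b (m + l) w)"
    using assms bounds by (simp add: run_simps)
  also have "reaches 2 \<dots> (config 12 l (Suc j) a' b' (m + l) w)"
    using assms bounds by (simp add: run_simps)
  also have "reaches 3 \<dots> (if x ! a' < x ! b' then config 16 l j a' b' (m + l) w
      else config 16 (Suc l) (Suc j) a' b' (m + l) w)"
    using assms bounds by (simp add: run_simps)
  finally show ?thesis by simp
qed

lemma search_step:
  assumes "search_invariant ((!) x) m l h a b" "p \<le> 2 * m" "l < h"
  shows "\<exists>l' h' a' b' p'. search_invariant ((!) x) m l' h' a' b' \<and> p' \<le> 2 * m \<and>
    h - l = Suc (h' - l') \<and> reaches 10 (config 16 l h a b p w) (config 16 l' h' a' b' p' w)"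
proof -
  obtain j where h: "h = Suc j" and j: "l \<le> j" "j \<le> m"
    using assms(1,3) by (cases h) (auto simp: search_invariant_def)
  define a' b' where "a' = better ((!) x) a j" and "b' = better ((!) x) b (m + l)"
  note invariant = search_invariant_step[OF assms(1)[unfolded h] j(1), folded a'_def b'_def]
  have iteration: "reaches 10 (config 16 l h a b p w)
      (if x ! a' < x ! b' then config 16 l j a' b' (m + l) w
       else config 16 (Suc l) (Suc j) a' b' (m + l) w)"
    using assms(1,2) j unfolding a'_def b'_def search_invariant_def h
    by (intro search_loop_body) auto
  show ?thesis
  proof (cases "x ! a' < x ! b'")
    case True
    with iteration invariant(1) j show ?thesis
      by (intro exI[of _ l] exI[of _ j] exI[of _ a'] exI[of _ b'] exI[of _ "m + l"])
        (simp add: h)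
  next
    case False
    with iteration invariant(2) j show ?thesis
      by (intro exI[of _ "Suc l"] exI[of _ "Suc j"] exI[of _ a'] exI[of _ b'] exI[of _ "m + l"])
        (simp add: h)
  qed
qed

lemma search_phase:
  assumes "search_invariant ((!) x) m l h a b" "p \<le> 2 * m"
  shows "\<exists>k a' b' p'. search_invariant ((!) x) m k k a' b' \<and> p' \<le> 2 * m \<and>
    reaches (10 * (h - l) + 1) (config 16 l h a b p w) (config 17 k k a' b' p' w)"
  using assms
proof (induction "h - l" arbitrary: l h a b p)
  case 0
  then have "l = h" by (simp add: search_invariant_def)
  moreover from this have "reaches 1 (config 16 l h a b p w) (config 17 h h a b p w)"
    using 0 by (simp add: run_simps search_invariant_def)
  ultimately show ?case using 0 by fastforce
next
  case (Suc d)
  then obtain l' h' a' b' p' where inv: "search_invariant ((!) x) m l' h' a' b'" "p' \<le> 2 * m"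
    and d: "d = h' - l'"
    and iteration: "reaches 10 (config 16 l h a b p w) (config 16 l' h' a' b' p' w)"
    using search_step[of l h a b p w] by force
  from Suc.hyps(1)[OF d inv] obtain k a'' b'' p'' where
    found: "search_invariant ((!) x) m k k a'' b''" "p'' \<le> 2 * m" and
    continue: "reaches (10 * d + 1) (config 16 l' h' a' b' p' w) (config 17 k k a'' b'' p'' w)"
    using d by blast
  note iteration also note continue
  finally have "reaches (10 * (h - l) + 1) (config 16 l h a b p w) (config 17 k k a'' b'' p'' w)"
    by (simp flip: Suc.hyps(2))
  with found show ?case by blast
qed

abbreviation window_entry :: "nat \<Rightarrow> nat \<times> 'a" where
  "window_entry i \<equiv> (i, window_max ((!) x) m i)"

lemma output_right_step:
  assumes "l \<le> m" "h \<le> Suc m" "a \<le> m" "b \<le> 2 * m" "p \<le> 2 * m"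
    and "left_max ((!) x) m l \<le> right_max ((!) x) m l" "right_pending ((!) x) m l b"
  shows "\<exists>b'. argmax_on ((!) x) {m..m + l} b' \<and>
    reaches 7 (config 17 l h a b p w) (config 17 (Suc l) h a b' (m + l) (window_entry l # w))"
proof -
  define b' where "b' = better ((!) x) b (m + l)"
  have argmax: "argmax_on ((!) x) {m..m + l} b'"
    using assms(7) unfolding b'_def by (rule argmax_on_right)
  then have bound: "b' \<le> 2 * m"
    using assms(1) by (auto simp: argmax_on_def)
  have entry: "(l, x ! b') = window_entry l"
    using right_max_eq_argmax[OF argmax] assms(1,6) by (simp add: window_max_eq_max)
  have "reaches 4 (config 17 l h a b p w) (config 21 l h a b' (m + l) w)"
    using assms b'_def by (simp add: run_simps)
  also have "reaches 3 \<dots> (config 17 (Suc l) h a b' (m + l) (window_entry l # w))"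
    using assms bound by (simp add: run_simps flip: entry)
  finally show ?thesis using argmax by auto
qed

lemma output_right_phase:
  assumes "l \<le> Suc m" "h \<le> Suc m" "a \<le> m" "b \<le> 2 * m" "p \<le> 2 * m"
    and "\<forall>i\<in>{l..m}. left_max ((!) x) m i \<le> right_max ((!) x) m i" "right_pending ((!) x) m l b"
  shows "\<exists>b' p'. b' \<le> 2 * m \<and> p' \<le> 2 * m \<and>
    reaches (7 * (Suc m - l) + 1) (config 17 l h a b p w)
      (config 24 (Suc m) h a b' p' (rev (map window_entry [l..<Suc m]) @ w))"
  using assms
proof (induction arbitrary: b p w rule: inc_induct)
  case base
  then have "reaches 1 (config 17 (Suc m) h a b p w) (config 24 (Suc m) h a b p w)"
    by (simp add: run_simps)
  with base show ?case by auto
next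
  case (step l)
  then obtain b' where argmax: "argmax_on ((!) x) {m..m + l} b'" and iteration:
    "reaches 7 (config 17 l h a b p w) (config 17 (Suc l) h a b' (m + l) (window_entry l # w))"
    using output_right_step[of l h a b p w] by auto
  have "b' \<le> 2 * m" "m + l \<le> 2 * m"
    using argmax step.hyps by (auto simp: argmax_on_def)
  moreover have "\<forall>i\<in>{Suc l..m}. left_max ((!) x) m i \<le> right_max ((!) x) m i"
    using step.prems(5) by simp
  ultimately obtain b'' p'' where bounds: "b'' \<le> 2 * m" "p'' \<le> 2 * m" and continue:
    "reaches (7 * (Suc m - Suc l) + 1) (config 17 (Suc l) h a b' (m + l) (window_entry l # w))
       (config 24 (Suc m) h a b'' p''
         (rev (map window_entry [Suc l..<Suc m]) @ window_entry l # w))"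
    using step.IH step.prems(1,2) right_pending_if_argmax_on(2)[OF argmax] by blast
  note iteration also note continue
  finally have "reaches (7 * (Suc m - l) + 1) (config 17 l h a b p w)
      (config 24 (Suc m) h a b'' p'' (rev (map window_entry [l..<Suc m]) @ w))"
    using step.hyps by (simp add: upt_conv_Cons Suc_diff_le)
  with bounds show ?case by blast
qed

lemma output_left_step:
  assumes "l \<le> Suc m" "j \<le> m" "a \<le> m" "b \<le> 2 * m" "p \<le> 2 * m"
    and "right_max ((!) x) m j \<le> left_max ((!) x) m j" "left_pending ((!) x) m (Suc j) a"
  shows "\<exists>a'. argmax_on ((!) x) {j..m} a' \<and>
    reaches 6 (config 24 l (Suc j) a b p w) (config 24 l j a' b p (window_entry j # w))"
proof -
  define a' where "a' = better ((!) x) a j"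
  have argmax: "argmax_on ((!) x) {j..m} a'"
    using assms(7,2) unfolding a'_def by (rule argmax_on_left)
  then have bound: "a' \<le> m"
    by (simp add: argmax_on_def)
  have entry: "(j, x ! a') = window_entry j"
    using left_max_eq_argmax[OF argmax] assms(2,6) by (simp add: window_max_eq_max)
  have "reaches 4 (config 24 l (Suc j) a b p w) (config 28 l j a' b p w)"
    using assms a'_def by (simp add: run_simps)
  also have "reaches 2 \<dots> (config 24 l j a' b p (window_entry j # w))"
    using assms bound by (simp add: run_simps flip: entry)
  finally show ?thesis using argmax by auto
qed

lemma output_left_phase:
  assumes "l \<le> Suc m" "h \<le> Suc m" "a \<le> m" "b \<le> 2 * m" "p \<le> 2 * m"
    and "\<forall>i<h. right_max ((!) x) m i \<le> left_max ((!) x) m i" "left_pending ((!) x) m h a"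
  shows "\<exists>a'. reaches (6 * h + 1) (config 24 l h a b p w)
    (config 30 l 0 a' b p (map window_entry [0..<h] @ w))"
  using assms
proof (induction h arbitrary: a w)
  case 0
  then have "reaches 1 (config 24 l 0 a b p w) (config 30 l 0 a b p w)"
    by (simp add: run_simps)
  then show ?case by auto
next
  case (Suc j)
  then obtain a' where argmax: "argmax_on ((!) x) {j..m} a'" and iteration:
    "reaches 6 (config 24 l (Suc j) a b p w) (config 24 l j a' b p (window_entry j # w))"
    using output_left_step[of l j a b p w] by auto
  have "a' \<le> m" using argmax by (simp add: argmax_on_def)
  then obtain a'' where continue:
    "reaches (6 * j + 1) (config 24 l j a' b p (window_entry j # w))
       (config 30 l 0 a'' b p (map window_entry [0..<j] @ window_entry j # w))"
    using Suc.IH[of a'] Suc.prems left_pending_if_argmax_on(1)[OF argmax] by auto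
  note iteration also note continue
  finally show ?case by (auto simp: upt_Suc)
qed

lemma enumerate_sliding_Max:
  "List.enumerate 0 (sliding (Suc m) (Suc m) (\<lambda>a. Max (set a)) x) =
     map window_entry [0..<Suc m]"
proof -
  have "set (take (Suc m) (drop i x)) = (!) x ` {i..i + m}" if "i \<le> m" for i
  proof -
    have "take (Suc m) (drop i x) = map ((!) x) [i..<Suc (i + m)]"
      using that length_x by (intro nth_equalityI) auto
    then show ?thesis
      by (simp add: atLeastLessThanSuc_atLeastAtMost)
  qed
  then show ?thesis
    unfolding sliding_def enumerate_map_upt window_max_def by simp
qed

lemma max_program_computes_centred:
  "computes_within max_program x (sliding (Suc m) (Suc m) (\<lambda>a. Max (set a)) x)
     (max_time (Suc m)) (max_space (Suc m))"
proof -
  obtain k a b p where inv: "search_invariant ((!) x) m k k a b" "p \<le> 2 * m"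
    and search: "reaches (10 * Suc m + 1) (config 16 0 (Suc m) m m 0 []) (config 17 k k a b p [])"
    using search_phase[OF search_invariant_initial, of 0 "[]"] by auto
  then have k: "k \<le> Suc m" by (simp add: search_invariant_def)
  let ?right = "rev (map window_entry [k..<Suc m])"
  obtain b' p' where "b' \<le> 2 * m" "p' \<le> 2 * m" and right:
    "reaches (7 * (Suc m - k) + 1) (config 17 k k a b p []) (config 24 (Suc m) k a b' p' ?right)"
    using output_right_phase[of k k a b p "[]"] inv
    by (auto simp: search_invariant_def threshold_between_def)
  then obtain a' where left: "reaches (6 * k + 1) (config 24 (Suc m) k a b' p' ?right)
      (config 30 (Suc m) 0 a' b' p' (map window_entry [0..<k] @ ?right))"
    using output_left_phase[of "Suc m" k a b' p' ?right] inv
    by (auto simp: search_invariant_def threshold_between_def)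
  note setup_phase also note search also note right also note left
  finally have "reaches (max_time (Suc m)) (init x)
      (config 30 (Suc m) 0 a' b' p' (map window_entry [0..<k] @ ?right))"
    by (rule reaches_within_mono) (use k in \<open>simp add: max_time_def\<close>)
  then show ?thesis
  proof (rule computes_within_if_reaches_within)
    have "map window_entry [0..<Suc m] = map window_entry [0..<k] @ map window_entry [k..<Suc m]"
      using k upt_add_eq_append[of 0 k "Suc m - k"] by (simp flip: map_append)
    then show "mset (written (config 30 (Suc m) 0 a' b' p' (map window_entry [0..<k] @ ?right))) =
        mset (List.enumerate 0 (sliding (Suc m) (Suc m) (\<lambda>a. Max (set a)) x))"
      unfolding enumerate_sliding_Max by simp
  qed (simp add: halted_def max_program_def)
qed

end

lemma max_program_computes:
  assumes "1 \<le> n" "length x = 2 * n - 1"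
  shows "computes_within max_program x (sliding n n (\<lambda>a. Max (set a)) x) (max_time n) (max_space n)"
  using max_program_computes_centred[of x "n - 1"] assms by simp

lemma min_program_computes:
  assumes "1 \<le> n" "length x = 2 * n - 1"
  shows "computes_within (map swap_compare max_program) x (sliding n n (\<lambda>a. Min (set a)) x)
    (max_time n) (max_space n)"
proof (rule computes_within_reversed[where g = dual])
  have "Max (set (take n (drop i (map dual x)))) = dual (Min (set (take n (drop i x))))"
    if "i < n" for i
    using that assms Max_dual_image[of "set (take n (drop i x))"]
    by (simp add: drop_map take_map)
  then have "map dual (sliding n n (\<lambda>a. Min (set a)) x) =
      sliding n n (\<lambda>a. Max (set a)) (map dual x)"
    by (simp add: sliding_def)
  then show "computes_within max_program (map dual x)
      (map dual (sliding n n (\<lambda>a. Min (set a)) x)) (max_time n) (max_space n)"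
    using max_program_computes[of n "map dual x"] assms by simp
qed simp

section \<open>Asymptotic bounds\<close>

lemma const_bigo_ln: "(\<lambda>_. c) \<in> O(\<lambda>n. ln (real n))" for c :: real
proof -
  have "LIM n sequentially. ln (real n) :> at_infinity"
    using filterlim_compose[OF ln_at_top filterlim_real_sequentially]
    by (rule filterlim_at_top_imp_at_infinity)
  then show ?thesis
    by (intro landau_o.small_imp_big smalloI_tendsto tendsto_divide_0)
      (auto intro: eventually_mono[OF eventually_gt_at_top[of 1]])
qed

lemma real_floorlog_le_log: "0 < n \<Longrightarrow> 1 < b \<Longrightarrow> real (floorlog b n) \<le> log b n + 1"
  by (simp add: floorlog_def)

lemma floorlog_bigo_ln: "(\<lambda>n. real (floorlog b n)) \<in> O(\<lambda>n. ln (real n))"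
proof (cases "1 < b")
  case True
  have "(\<lambda>n. real (floorlog b n)) \<in> O(\<lambda>n. log b n + 1)"
  proof (intro landau_o.big_mono eventually_mono[OF eventually_gt_at_top[of 0]])
    show "norm (real (floorlog b n)) \<le> norm (log b n + 1)" if "0 < n" for n
      using real_floorlog_le_log[OF that True] by simp
  qed
  also have "(\<lambda>n. log b (real n) + 1) \<in> O(\<lambda>n. ln (real n))"
    using True by (intro sum_in_bigo const_bigo_ln) (simp add: log_def)
  finally show ?thesis .
qed (simp add: floorlog_def)

lemma max_time_bigo: "(\<lambda>n. real (max_time n)) \<in> O(\<lambda>n. real n * ln (real n))"
proof -
  have "(\<lambda>n. real (max_time n)) \<in> O(\<lambda>n. real n * 1)"
    unfolding max_time_def
    by (intro bigoI[of _ 26] eventually_mono[OF eventually_gt_at_top[of 0]]) simp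
  also have "(\<lambda>n. real n * 1) \<in> O(\<lambda>n. real n * ln (real n))"
    by (intro landau_o.big.mult_left const_bigo_ln)
  finally show ?thesis .
qed

lemma max_space_bigo: "(\<lambda>n. real (max_space n)) \<in> O(\<lambda>n. ln (real n))"
proof -
  have "real (max_space n) = 8 * real (floorlog 2 8 + 1) + 8 * real (floorlog 2 n)" if "0 < n" for n
    using that floorlog_power[of n 2 1] by (simp add: max_space_def mult.commute)
  then have "eventually (\<lambda>n. real (max_space n) =
      8 * real (floorlog 2 8 + 1) + 8 * real (floorlog 2 n)) sequentially"
    by (rule eventually_mono[OF eventually_gt_at_top])
  moreover have "(\<lambda>n. 8 * real (floorlog 2 8 + 1) + 8 * real (floorlog 2 n)) \<in> O(\<lambda>n. ln (real n))"
    by (intro sum_in_bigo const_bigo_ln) (simp add: floorlog_bigo_ln)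
  ultimately show ?thesis
    using landau_o.big.in_cong by fast
qed

theorem theorem4p1:
  shows
    "(\<exists>(P :: instr list) (T :: nat \<Rightarrow> nat) (S :: nat \<Rightarrow> nat).
        (\<lambda>n. real (T n)) \<in> O(\<lambda>n. real n * ln (real n)) \<and>
        (\<lambda>n. real (S n)) \<in> O(\<lambda>n. ln (real n)) \<and>
        (\<forall>n\<ge>1. \<forall>x :: 'a::linorder list. length x = 2 * n - 1 \<longrightarrow>
           computes_within P x (sliding n n (\<lambda>a. Max (set a)) x) (T n) (S n))) \<and>
     (\<exists>(P :: instr list) (T :: nat \<Rightarrow> nat) (S :: nat \<Rightarrow> nat).
        (\<lambda>n. real (T n)) \<in> O(\<lambda>n. real n * ln (real n)) \<and>
        (\<lambda>n. real (S n)) \<in> O(\<lambda>n. ln (real n)) \<and>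
        (\<forall>n\<ge>1. \<forall>x :: 'a::linorder list. length x = 2 * n - 1 \<longrightarrow>
           computes_within P x (sliding n n (\<lambda>a. Min (set a)) x) (T n) (S n)))"
  using max_time_bigo max_space_bigo max_program_computes min_program_computes by blast

end
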